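(* Let $n,m\ge3$ be odd integers and let $S$ and $T$ be 2-partitions of $\mathbb{Z}_n^*$ and $\mathbb{Z}_m^*$ respectively. Then every product $W_{ST}$ of $S$ and $T$ is a 2-partition of $\mathbb{Z}_{mn}^*$.
   Context: $\mathbb{Z}_k^*=\mathbb{Z}_k\setminus\{0\}$; a 2-partition of $\mathbb{Z}_k^*$ is a partition of it into unordered pairs. Product: let $n=2q+1$, $m=2p+1$. Let $\tilde S$ be any set of ordered pairs obtained by ordering each pair of $S$ in either way. Let $\bar T=\{(r_j,t_j)\}_{j=1}^p$ be obtained by ordering each pair of $T$ so that $\bigcup_j\{\pm r_j\}=\mathbb{Z}_m^*$, and $\bar T'=\{(-r_j,-t_j)\}_{j=1}^p$. A product $W_{ST}$ is the collection of $2pq+p+q$ unordered pairs $\{nr+x,\ nt+y\}$ (mod $nm$, with $x,y$ represented in $\{0,\dots,n-1\}$) of two types: (i) one pair for each $(r,t)\in\bar T\cup\bar T'\cup\{(0,0)\}$ and each $(x,y)\in\tilde S$; (ii) one pair for each $(r,t)\in\bar T$ with $x=y=0$. *)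

theory Defs
  imports "HOL-Number_Theory.Residues" "HOL-Library.Disjoint_Sets"
begin

text \<open>
  The ring of integers modulo \<open>k\<close> is \<open>residue_ring k\<close>, whose carrier consists of the
  representatives \<open>{0..k - 1}\<close>.
\<close>

definition Zstar :: "int \<Rightarrow> int set" where
  "Zstar k = carrier (residue_ring k) - {\<zero>\<^bsub>residue_ring k\<^esub>}"

definition two_partition :: "'a set \<Rightarrow> 'a set set \<Rightarrow> bool" where
  "two_partition A P \<longleftrightarrow> partition_on A P \<and> (\<forall>B\<in>P. card B = 2)"

text \<open>
  Bijectivity says that \<open>R\<close> contains exactly one of the two orderings \<open>(x, y)\<close>, \<open>(y, x)\<close>
  of every pair \<open>{x, y}\<close> in \<open>P\<close>, and nothing else.
\<close>

definition pair_ordering :: "'a set set \<Rightarrow> ('a \<times> 'a) set \<Rightarrow> bool" where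
  "pair_ordering P R \<longleftrightarrow> bij_betw (\<lambda>(x, y). {x, y}) R P"

definition half_ordering :: "int \<Rightarrow> int set set \<Rightarrow> (int \<times> int) set \<Rightarrow> bool" where
  "half_ordering m T R \<longleftrightarrow>
     pair_ordering T R \<and> (\<Union>(r, t)\<in>R. {r, \<ominus>\<^bsub>residue_ring m\<^esub> r}) = Zstar m"

definition neg_pairs :: "int \<Rightarrow> (int \<times> int) set \<Rightarrow> (int \<times> int) set" where
  "neg_pairs m R = (\<lambda>(r, t). (\<ominus>\<^bsub>residue_ring m\<^esub> r, \<ominus>\<^bsub>residue_ring m\<^esub> t)) ` R"

text \<open>
  Since elements of \<open>residue_ring n\<close> already lie in \<open>{0..n - 1}\<close>, they serve as the required
  representatives; \<open>n * r\<close> modulo \<open>n * m\<close> does not depend on the representative of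
  \<open>r\<close> modulo \<open>m\<close>.
\<close>

definition prod_pair :: "int \<Rightarrow> int \<Rightarrow> int \<times> int \<Rightarrow> int \<times> int \<Rightarrow> int set" where
  "prod_pair n m = (\<lambda>(r, t) (x, y). {(n * r + x) mod (n * m), (n * t + y) mod (n * m)})"

definition product_of_orderings ::
    "int \<Rightarrow> int \<Rightarrow> (int \<times> int) set \<Rightarrow> (int \<times> int) set \<Rightarrow> int set set" where
  "product_of_orderings n m S' T' =
     {prod_pair n m a b | a b. a \<in> T' \<union> neg_pairs m T' \<union> {(0, 0)} \<and> b \<in> S'} \<union>
     {prod_pair n m a (0, 0) | a. a \<in> T'}"

definition is_product ::
    "int \<Rightarrow> int \<Rightarrow> int set set \<Rightarrow> int set set \<Rightarrow> int set set \<Rightarrow> bool" where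
  "is_product n m S T W \<longleftrightarrow>
     (\<exists>S' T'. pair_ordering S S' \<and> half_ordering m T T' \<and> W = product_of_orderings n m S' T')"

end

theory Submission imports Defs begin

text \<open>
  The product covers \<open>\<int>\<^sub>m\<^sub>n\<^sup>*\<close> and consists of at most \<open>(mn - 1) / 2\<close> sets of at most two
  elements each, so by counting they are genuine, pairwise disjoint pairs. Covering \<open>n c + x\<close>
  when \<open>x\<close> is the second entry of its pair requires the second entries of \<open>T'\<close> to represent,
  up to sign, all of \<open>\<int>\<^sub>m\<^sup>*\<close>: this holds because the first entries form a half system, whose
  complement (the set of second entries) consists of their negatives.
\<close>

section \<open>Recognizing 2-partitions by counting\<close>

lemma card_Union_le_mult:
  assumes "finite W" and "\<And>B. B \<in> W \<Longrightarrow> card B \<le> k"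
  shows "card (\<Union>W) \<le> k * card W"
proof -
  have "card (\<Union>W) \<le> (\<Sum>B\<in>W. card B)"
    by (rule card_Union_le_sum_card)
  also have "\<dots> \<le> card W * k"
    using sum_bounded_above[of W card k] assms(2) by simp
  finally show ?thesis by (simp add: mult.commute)
qed

text \<open>A cover of \<open>A\<close> by sets of size at most two has no slack if it uses at most
  half as many sets as \<open>A\<close> has elements; this replaces a case-by-case check of
  disjointness. Assumption \<open>fin_elems\<close> excludes infinite members, whose
  \<open>card\<close> is 0 and would pass the bound \<open>le2\<close>.\<close>

lemma two_partition_if_few_sets:
  assumes fin: "finite W" and fin_elems: "\<And>B. B \<in> W \<Longrightarrow> finite B"
    and le2: "\<And>B. B \<in> W \<Longrightarrow> card B \<le> 2"
    and Un: "\<Union>W = A" and few: "2 * card W \<le> card A"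
  shows "two_partition A W"
proof -
  have key: "card B = 2 \<and> B \<inter> \<Union>(W - {B}) = {}" if "B \<in> W" for B
  proof -
    define U where "U = \<Union>(W - {B})"
    have finU: "finite U" and finB: "finite B"
      using fin fin_elems that by (auto simp: U_def)
    have "card U \<le> 2 * card (W - {B})"
      unfolding U_def by (rule card_Union_le_mult) (use fin le2 in auto)
    moreover have "card (W - {B}) = card W - 1" and "card W > 0"
      using that fin by (auto simp: card_gt_0_iff)
    moreover have "B \<union> U = A"
      using that Un by (auto simp: U_def)
    \<comment> \<open>Inclusion-exclusion gives |A| + |B Int U| = |B| + |U|, which is at most 2 +
      2(|W| - 1) = 2|W| and hence at most |A|. So every bound is tight and the intersection is
      empty. Positivity of \<open>card W\<close> keeps the truncated subtraction honest.\<close>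
    ultimately have "card B = 2 \<and> card (B \<inter> U) = 0"
      using card_Un_Int[OF finB finU] le2[OF that] few by simp linarith
    then show ?thesis
      using finB by (simp add: U_def)
  qed
  have "disjoint W"
  proof (rule disjointI)
    fix B C assume "B \<in> W" "C \<in> W" "B \<noteq> C"
    then show "B \<inter> C = {}" using key[of B] by blast
  qed
  moreover have "{} \<notin> W"
    using key by fastforce
  ultimately show ?thesis
    using key Un by (auto simp: two_partition_def partition_on_def)
qed

lemma card_two_partition:
  assumes "two_partition A P" and "finite A"
  shows "card A = 2 * card P"
proof -
  have P: "\<Union>P = A" "disjoint P" "\<And>B. B \<in> P \<Longrightarrow> card B = 2"
    using assms(1) by (auto simp: two_partition_def partition_on_def)
  have "card (\<Union>P) = (\<Sum>B\<in>P. card B)"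
    using P(2) P(1) assms(2)
    by (intro card_Union_disjoint) (auto simp: disjoint_def pairwise_def disjnt_def intro: finite_subset)
  then show ?thesis
    using P(1,3) by simp
qed

section \<open>Orderings of a 2-partition of \<open>Zstar k\<close> and half systems\<close>

lemma pair_ordering_entries:
  assumes "pair_ordering P R"
  shows "fst ` R \<union> snd ` R = \<Union>P"
proof -
  have "\<Union>P = (\<Union>(x, y)\<in>R. {x, y})"
    using assms by (auto simp: pair_ordering_def bij_betw_def)
  also have "\<dots> = fst ` R \<union> snd ` R"
    by force
  finally show ?thesis by simp
qed

lemma Zstar_eq: "k > 1 \<Longrightarrow> Zstar k = {1..<k}"
  by (auto simp: Zstar_def residue_ring_def)

text \<open>Excluding 0 matters: the negative of 0 is represented by 0, while \<open>k - 0\<close>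
  falls outside \<open>{0..k - 1}\<close>.\<close>

lemma residue_ring_neg_eq:
  assumes "k > 1" and "x \<in> Zstar k"
  shows "\<ominus>\<^bsub>residue_ring k\<^esub> x = k - x"
proof -
  interpret residues k "residue_ring k"
    using assms(1) by unfold_locales simp_all
  have "\<ominus>\<^bsub>residue_ring k\<^esub> x = (- x) mod k"
    by (rule res_neg_eq)
  also have "\<dots> = (k - x) mod k"
    by simp
  also have "\<dots> = k - x"
    using assms by (intro mod_pos_pos_trivial) (auto simp: Zstar_eq)
  finally show ?thesis .
qed

lemma two_partition_ordering_facts:
  assumes "k > 1" and "two_partition (Zstar k) P" and "pair_ordering P R"
  shows "fst ` R \<union> snd ` R = {1..<k}" "finite R" "2 * int (card R) = k - 1"
proof -
  show "fst ` R \<union> snd ` R = {1..<k}"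
    using pair_ordering_entries[OF assms(3)] assms(1,2)
    by (simp add: two_partition_def partition_on_def Zstar_eq)
  have fin: "finite (Zstar k)"
    using assms(1) by (simp add: Zstar_eq)
  have "\<Union>P = Zstar k"
    using assms(2) by (simp add: two_partition_def partition_on_def)
  then have "finite P"
    using fin by (metis finite_UnionD)
  then show "finite R"
    using assms(3) bij_betw_finite by (auto simp: pair_ordering_def)
  have "card R = card P"
    using assms(3) bij_betw_same_card by (auto simp: pair_ordering_def)
  then show "2 * int (card R) = k - 1"
    using card_two_partition[OF assms(2) fin] assms(1) by (simp add: Zstar_eq)
qed

lemma half_ordering_fst_cover:
  assumes "m > 1" and "half_ordering m T R" and "two_partition (Zstar m) T"
  shows "fst ` R \<union> (\<lambda>r. m - r) ` fst ` R = {1..<m}"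
proof -
  have "fst ` R \<subseteq> Zstar m"
    using two_partition_ordering_facts(1)[OF assms(1,3)] assms(1,2)
    by (auto simp: half_ordering_def Zstar_eq)
  then have neg: "\<ominus>\<^bsub>residue_ring m\<^esub> r = m - r" if "(r, t) \<in> R" for r t
    using residue_ring_neg_eq[OF assms(1)] that by force
  have "Zstar m = (\<Union>(r, t)\<in>R. {r, \<ominus>\<^bsub>residue_ring m\<^esub> r})"
    using assms(2) by (simp add: half_ordering_def)
  also have "\<dots> = (\<Union>(r, t)\<in>R. {r, m - r})"
    by (intro SUP_cong refl) (use neg in auto)
  also have "\<dots> = fst ` R \<union> (\<lambda>r. m - r) ` fst ` R"
    by force
  finally show ?thesis
    using assms(1) by (simp add: Zstar_eq)
qed

lemma half_ordering_snd_cover: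
  assumes "m > 1" and "half_ordering m T R" and "two_partition (Zstar m) T"
  shows "snd ` R \<union> (\<lambda>t. m - t) ` snd ` R = {1..<m}"
proof -
  let ?F = "fst ` R" and ?N = "(\<lambda>r. m - r) ` fst ` R"
  have ord: "pair_ordering T R"
    using assms(2) by (simp add: half_ordering_def)
  note facts = two_partition_ordering_facts[OF assms(1,3) ord]
  have cover: "?F \<union> ?N = {1..<m}"
    by (rule half_ordering_fst_cover[OF assms])
  \<comment> \<open>Each of the two sets has at most (m - 1)/2 elements, yet together they fill a
    set of size m - 1, so they cannot overlap. Thus no first entry is the negative of a first
    entry.\<close>
  have "card ?F \<le> card R" "card ?N \<le> card R"
    using facts(2) by (auto simp: image_image intro: card_image_le)
  moreover have "card ?F + card ?N = card {1..<m} + card (?F \<inter> ?N)"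
    using card_Un_Int[of ?F ?N] facts(2) cover by simp
  ultimately have "card (?F \<inter> ?N) = 0"
    using facts(3) by simp
  then have disj: "?F \<inter> ?N = {}"
    using facts(2) by simp
  have "z \<in> snd ` R \<union> (\<lambda>t. m - t) ` snd ` R" if z: "z \<in> {1..<m}" for z
  proof (cases "z \<in> snd ` R")
    case False
    \<comment> \<open>Since \<open>z\<close> is not a second entry, it is a first entry. Its
      negative is then not a first entry and must be a second one, so \<open>z\<close> is reached as
      the negative of a second entry.\<close>
    then have "m - z \<in> ?N"
      using z facts(1) by blast
    then have "m - z \<notin> ?F"
      using disj by blast
    moreover have "m - z \<in> {1..<m}"
      using z by auto
    ultimately have "m - z \<in> snd ` R"
      using facts(1) by blast
    then have "m - (m - z) \<in> (\<lambda>t. m - t) ` snd ` R"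
      by (rule imageI)
    then show ?thesis by simp
  qed simp
  moreover have "z \<in> {1..<m} \<and> m - z \<in> {1..<m}" if "z \<in> snd ` R" for z
  proof -
    have "z \<in> {1..<m}"
      using that facts(1) by blast
    then show ?thesis by auto
  qed
  ultimately show ?thesis
    by blast
qed

section \<open>Base-n digits and the union of the product\<close>

lemma neg_pairs_eq:
  assumes "m > 1" and "R \<subseteq> Zstar m \<times> Zstar m"
  shows "neg_pairs m R = (\<lambda>(r, t). (m - r, m - t)) ` R"
  unfolding neg_pairs_def
  by (rule image_cong) (use assms residue_ring_neg_eq in auto)

lemma prod_pair_eq:
  fixes n m :: int
  assumes "n > 0" and "r \<in> {0..<m}" "t \<in> {0..<m}" "x \<in> {0..<n}" "y \<in> {0..<n}"
  shows "prod_pair n m (r, t) (x, y) = {n * r + x, n * t + y}"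
proof -
  have "(n * c + z) mod (n * m) = n * c + z" if "c \<in> {0..<m}" "z \<in> {0..<n}" for c z
  proof -
    \<comment> \<open>Since c is at most m - 1, the block of n integers starting at n c ends before
      n m, so reduction modulo n m changes nothing.\<close>
    have "n * (c + 1) \<le> n * m"
      using that assms(1) by (intro mult_left_mono) auto
    then have "n * c + z < n * m"
      using that by (simp add: algebra_simps)
    moreover have "0 \<le> n * c + z"
      using that assms(1) by auto
    ultimately show ?thesis
      by (rule mod_pos_pos_trivial[rotated])
  qed
  then show ?thesis
    using assms by (simp add: prod_pair_def)
qed

text \<open>The only number with two digits below n m that must be avoided is 0, whose digits both
  vanish.\<close>

lemma digits_mem_iff:
  fixes n m :: int
  assumes "c \<in> {0..<m}" "z \<in> {0..<n}"
  shows "n * c + z \<in> {1..<n * m} \<longleftrightarrow> c \<noteq> 0 \<or> z \<noteq> 0"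
proof -
  have "n * (c + 1) \<le> n * m"
    using assms by (intro mult_left_mono) auto
  then have "n * c + z < n * m"
    using assms by (simp add: algebra_simps)
  moreover have "0 < n * c + z" if "c \<noteq> 0"
    using assms that by (intro add_pos_nonneg mult_pos_pos) auto
  ultimately show ?thesis
    using assms by (cases "c = 0") (fastforce, simp add: int_one_le_iff_zero_less)
qed

text \<open>Each w is split by division into a high digit c and a low digit z. If z is nonzero, a
  type (i) pair is wanted: its position in a pair of \<open>S'\<close> dictates which coordinate of
  a pair in \<open>Q\<close> must equal c, so both projections of \<open>Q\<close> have to be onto.
  If z = 0, a type (ii) pair serves.\<close>

lemma Union_product_of_orderings:
  fixes n m :: int
  assumes n: "n > 1" and m: "m > 1"
    and S': "fst ` S' \<union> snd ` S' = {1..<n}"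
    and T': "fst ` T' \<union> snd ` T' = {1..<m}"
    and fst_cover: "fst ` T' \<union> (\<lambda>r. m - r) ` fst ` T' = {1..<m}"
    and snd_cover: "snd ` T' \<union> (\<lambda>t. m - t) ` snd ` T' = {1..<m}"
  shows "\<Union>(product_of_orderings n m S' T') = {1..<n * m}"
proof -
  define Q where "Q = T' \<union> neg_pairs m T' \<union> {(0, 0)}"
  have T'_sub: "T' \<subseteq> {1..<m} \<times> {1..<m}"
    using T' by force
  have Q_eq: "Q = T' \<union> (\<lambda>(r, t). (m - r, m - t)) ` T' \<union> {(0, 0)}"
    unfolding Q_def using neg_pairs_eq[OF m, of T'] T'_sub m by (simp add: Zstar_eq)
  have Q_sub: "Q \<subseteq> {0..<m} \<times> {0..<m}"
    unfolding Q_eq using T'_sub m by auto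
  have "fst ` Q = fst ` T' \<union> (\<lambda>r. m - r) ` fst ` T' \<union> {0}"
    unfolding Q_eq by (simp add: image_Un image_image case_prod_beta)
  \<comment> \<open>The adjoined pair (0, 0) supplies the high digit 0, which neither
    \<open>T'\<close> nor its negatives provide.\<close>
  then have Q_fst: "fst ` Q = {0..<m}"
    unfolding fst_cover using m by auto
  have "snd ` Q = snd ` T' \<union> (\<lambda>t. m - t) ` snd ` T' \<union> {0}"
    unfolding Q_eq by (simp add: image_Un image_image case_prod_beta)
  then have Q_snd: "snd ` Q = {0..<m}"
    unfolding snd_cover using m by auto
  have S'_sub: "S' \<subseteq> {1..<n} \<times> {1..<n}"
    using S' by force
  have W_eq: "product_of_orderings n m S' T' =
      (\<lambda>((r, t), (x, y)). {n * r + x, n * t + y}) ` (Q \<times> S') \<union> (\<lambda>(r, t). {n * r, n * t}) ` T'"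
    (is "_ = ?A \<union> ?B")
  proof -
    have "{prod_pair n m a b | a b. a \<in> Q \<and> b \<in> S'} = (\<lambda>(a, b). prod_pair n m a b) ` (Q \<times> S')"
      by auto
    also have "\<dots> = ?A"
    proof (rule image_cong[OF refl], clarsimp)
      fix r t x y assume "(r, t) \<in> Q" "(x, y) \<in> S'"
      then show "prod_pair n m (r, t) (x, y) = {n * r + x, n * t + y}"
        using Q_sub S'_sub n by (intro prod_pair_eq) auto
    qed
    finally have A: "{prod_pair n m a b | a b. a \<in> Q \<and> b \<in> S'} = ?A" .
    have "{prod_pair n m a (0, 0) | a. a \<in> T'} = (\<lambda>a. prod_pair n m a (0, 0)) ` T'"
      by auto
    also have "\<dots> = ?B"
    proof (rule image_cong[OF refl], clarsimp)
      fix r t assume "(r, t) \<in> T'"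
      then show "prod_pair n m (r, t) (0, 0) = {n * r, n * t}"
        using prod_pair_eq[of n r m t 0 0] T'_sub n by auto
    qed
    finally show ?thesis
      using A by (simp add: product_of_orderings_def Q_def)
  qed
  show ?thesis
  proof (intro equalityI subsetI)
    fix w assume "w \<in> \<Union>(product_of_orderings n m S' T')"
    then consider (i) r t x y where "(r, t) \<in> Q" "(x, y) \<in> S'" "w = n * r + x \<or> w = n * t + y"
      \<comment> \<open>The summand 0 is kept so that these elements also appear as digit
        expansions, ready for \<open>digits_mem_iff\<close>.\<close>
      | (ii) r t where "(r, t) \<in> T'" "w = n * r + 0 \<or> w = n * t + 0"
      unfolding W_eq by fastforce
    then show "w \<in> {1..<n * m}"
    proof cases
      case i
      then have "r \<in> {0..<m}" "t \<in> {0..<m}" "x \<in> {1..<n}" "y \<in> {1..<n}"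
        using Q_sub S'_sub by auto
      then show ?thesis
        using i(3) digits_mem_iff[of r m x n] digits_mem_iff[of t m y n] by auto
    next
      case ii
      then have "r \<in> {1..<m}" "t \<in> {1..<m}"
        using T'_sub by auto
      then show ?thesis
        using ii(2) n digits_mem_iff[of r m 0 n] digits_mem_iff[of t m 0 n] by auto
    qed
  next
    fix w assume w: "w \<in> {1..<n * m}"
    define c z where "c = w div n" and "z = w mod n"
    have w_eq: "w = n * c + z"
      by (simp add: c_def z_def)
    have z: "z \<in> {0..<n}"
      using n by (simp add: z_def)
    have c: "c \<in> {0..<m}"
    proof -
      have "n * c \<le> w" "w < n * m"
        using w z w_eq by auto
      then have "n * c < n * m"
        by (rule le_less_trans)
      moreover have "0 \<le> c"
        using w n by (simp add: c_def pos_imp_zdiv_nonneg_iff)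
      ultimately show ?thesis
        using n by simp
    qed
    show "w \<in> \<Union>(product_of_orderings n m S' T')"
    proof (cases "z = 0")
      \<comment> \<open>As w is nonzero, c is nonzero too and is therefore an entry of some pair in
        \<open>T'\<close>.\<close>
      case True
      then have "c \<in> fst ` T' \<union> snd ` T'"
        using w c w_eq unfolding T' by (cases "c = 0") auto
      then obtain r t where rt: "(r, t) \<in> T'" "c = r \<or> c = t"
        by force
      have "{n * r, n * t} \<in> product_of_orderings n m S' T'"
        unfolding W_eq using rt(1) by (intro UnI2 image_eqI[of _ _ "(r, t)"]) auto
      moreover have "w \<in> {n * r, n * t}"
        using rt(2) w_eq True by auto
      ultimately show ?thesis
        by blast
    next
      case False
      then have "z \<in> fst ` S' \<union> snd ` S'"
        using z unfolding S' by auto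
      then show ?thesis
      proof
        assume "z \<in> fst ` S'"
        then obtain y where y: "(z, y) \<in> S'" by force
        obtain t where t: "(c, t) \<in> Q"
          using c Q_fst by force
        have "{n * c + z, n * t + y} \<in> product_of_orderings n m S' T'"
          unfolding W_eq using y t by (intro UnI1 image_eqI[of _ _ "((c, t), (z, y))"]) auto
        then show ?thesis
          unfolding w_eq by blast
      next
        assume "z \<in> snd ` S'"
        then obtain x where x: "(x, z) \<in> S'" by force
        obtain r where r: "(r, c) \<in> Q"
          using c Q_snd by force
        have "{n * r + x, n * c + z} \<in> product_of_orderings n m S' T'"
          unfolding W_eq using x r by (intro UnI1 image_eqI[of _ _ "((r, c), (x, z))"]) auto
        then show ?thesis
          unfolding w_eq by blast
      qed
    qed
  qed
qed

section \<open>Counting the sets of the product, and conclusion\<close>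

lemma card_product_of_orderings_le:
  assumes "finite S'" and "finite T'"
  shows "finite (product_of_orderings n m S' T')"
    and "card (product_of_orderings n m S' T') \<le> (2 * card T' + 1) * card S' + card T'"
proof -
  define Q where "Q = T' \<union> neg_pairs m T' \<union> {(0, 0)}"
  let ?A = "(\<lambda>(a, b). prod_pair n m a b) ` (Q \<times> S')"
  let ?B = "(\<lambda>a. prod_pair n m a (0, 0)) ` T'"
  have W: "product_of_orderings n m S' T' = ?A \<union> ?B"
    by (auto simp: product_of_orderings_def Q_def)
  have finQ: "finite Q"
    using assms by (simp add: Q_def neg_pairs_def)
  show "finite (product_of_orderings n m S' T')"
    unfolding W using assms finQ by simp
  \<comment> \<open>Upper bounds suffice here: coincidences among the pairs only lower the count,
    and the final counting criterion asks for few sets.\<close>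
  have "card (neg_pairs m T') \<le> card T'"
    unfolding neg_pairs_def by (rule card_image_le[OF assms(2)])
  then have "card Q \<le> 2 * card T' + 1"
    unfolding Q_def
    using card_Un_le[of "T' \<union> neg_pairs m T'" "{(0, 0)}"] card_Un_le[of T' "neg_pairs m T'"]
    by simp
  moreover have "card ?A \<le> card Q * card S'"
    using card_image_le[of "Q \<times> S'" "\<lambda>(a, b). prod_pair n m a b"] assms finQ
    by (simp add: card_cartesian_product)
  moreover have "card ?B \<le> card T'"
    by (rule card_image_le[OF assms(2)])
  ultimately show "card (product_of_orderings n m S' T') \<le> (2 * card T' + 1) * card S' + card T'"
    unfolding W using card_Un_le[of ?A ?B] mult_le_mono1[of "card Q" "2 * card T' + 1" "card S'"]
    by linarith
qed

theorem theorem2p8: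
  fixes n m :: int and S T W :: "int set set"
  assumes "n \<ge> 3" and "odd n" and "m \<ge> 3" and "odd m"
    and "two_partition (Zstar n) S" and "two_partition (Zstar m) T"
    and "is_product n m S T W"
  shows "two_partition (Zstar (m * n)) W"
proof -
  have n: "n > 1" and m: "m > 1"
    using assms by auto
  obtain S' T' where S': "pair_ordering S S'" and T': "half_ordering m T T'"
    and W: "W = product_of_orderings n m S' T'"
    using assms(7) by (auto simp: is_product_def)
  have T'_ord: "pair_ordering T T'"
    using T' by (simp add: half_ordering_def)
  note S'_facts = two_partition_ordering_facts[OF n assms(5) S']
  note T'_facts = two_partition_ordering_facts[OF m assms(6) T'_ord]
  have mn: "m * n > 1"
    using m n by (rule less_1_mult)
  show ?thesis
  proof (rule two_partition_if_few_sets)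
    show "finite W"
      unfolding W by (rule card_product_of_orderings_le(1)[OF S'_facts(2) T'_facts(2)])
    show "finite B" "card B \<le> 2" if B: "B \<in> W" for B
    proof -
      obtain a b where "B = prod_pair n m a b"
        using B unfolding W product_of_orderings_def by blast
      then show "finite B" "card B \<le> 2"
        by (simp_all add: prod_pair_def case_prod_beta card_insert_if)
    qed
    show "\<Union>W = Zstar (m * n)"
      unfolding W Zstar_eq[OF mn] unfolding mult.commute[of m n]
      by (intro Union_product_of_orderings n m S'_facts(1) T'_facts(1)
          half_ordering_fst_cover[OF m T' assms(6)] half_ordering_snd_cover[OF m T' assms(6)])
    have "int (card W) \<le> int ((2 * card T' + 1) * card S' + card T')"
      unfolding W of_nat_le_iff
      by (rule card_product_of_orderings_le(2)[OF S'_facts(2) T'_facts(2)])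
    then have "int (2 * card W) \<le> 2 * ((2 * int (card T') + 1) * int (card S') + int (card T'))"
      by (simp add: algebra_simps)
    \<comment> \<open>With p = |T'| and q = |S'|, twice the number of listed pairs is 2(2p + 1)q +
      2p = (2p + 1)(2q + 1) - 1. As 2p + 1 = m and 2q + 1 = n, this is exactly the size of
      \<open>Zstar (m * n)\<close>.\<close>
    also have "\<dots> = (2 * int (card T') + 1) * (2 * int (card S') + 1) - 1"
      by (simp add: algebra_simps)
    also have "\<dots> = m * n - 1"
      unfolding S'_facts(3) T'_facts(3) by simp
    finally show "2 * card W \<le> card (Zstar (m * n))"
      using mn by (simp add: Zstar_eq)
  qed
qed

end
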